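(* Let $X$ be a nonempty set equipped with a separated uniformity $\mathscr U$ generated by a nonempty family $\mathscr F$ of pseudometrics with associated collection $\mathscr V$ of basic entourages, and let $G$ be a directed graph with $V(G)=X$ and $E(G)\supseteq\Delta(X)$. The following statements are equivalent: (i) $G$ is weakly connected; (ii) for each Banach $G$-contraction $T:X\to X$ and each $x,y\in X$, the sequences $\{T^nx\}$ and $\{T^ny\}$ are Cauchy equivalent; (iii) each Banach $G$-contraction $T:X\to X$ has at most one fixed point in $X$.
   Context: Uniform structure: $\mathscr U$ is a uniformity on $X$; separated means $\bigcap\mathscr U=\Delta(X)=\{(x,x):x\in X\}$. $\mathscr F$ is a nonempty family of (uniformly continuous) pseudometrics on $X$ generating $\mathscr U$. For a pseudometric $\rho$ and $r>0$ put $V(\rho,r)=\{(x,y)\in X\times X:\rho(x,y)<r\}$. $\mathscr V$ is the collection of all sets $\bigcap_{i=1}^m V(\rho_i,r_i)$ with $m\ge1$, $\rho_i\in\mathscr F$, $r_i>0$; it is a base of $\mathscr U$ and its members are called basic entourages. For $V=\bigcap_{i=1}^mV(\rho_i,r_i)\in\mathscr V$ and $\alpha>0$, put $\alpha V=\bigcap_{i=1}^mV(\rho_i,\alpha r_i)$ (a basic entourage is regarded as given together with such a presentation, and $\alpha V$ is formed from it). Graphs: $G$ has vertex set $X$ and edge set $E(G)\subseteq X\times X$ (directed, no parallel edges) containing all loops. $\widetilde G$ has vertex set $X$ and $E(\widetilde G)=\{(x,y):(x,y)\in E(G)\text{ or }(y,x)\in E(G)\}$. $G$ is weakly connected if any two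 points $x,y\in X$ are joined by a path in $\widetilde G$, i.e. a finite sequence $x_0=x,\dots,x_N=y$ with $(x_{i-1},x_i)\in E(\widetilde G)$ for $i=1,\dots,N$. A mapping $T:X\to X$ is a Banach $G$-contraction if (B1) $(x,y)\in E(G)$ implies $(Tx,Ty)\in E(G)$ for all $x,y\in X$; and (B2) there is $\alpha\in(0,1)$ such that $(x,y)\in V\cap E(G)$ implies $(Tx,Ty)\in\alpha V$ for all $x,y\in X$ and all $V\in\mathscr V$. Two sequences $\{x_n\}$, $\{y_n\}$ in $X$ are Cauchy equivalent if both are Cauchy and for each $U\in\mathscr U$ there is $N>0$ such that $(x_n,y_n)\in U$ for all $n\ge N$. *)

theory Defs
  imports Complex_Main
begin

section \<open>Uniformities generated by pseudometrics\<close>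

definition entourages :: "('a::uniform_space \<times> 'a) set set"
  where "entourages = {U. eventually (\<lambda>p. p \<in> U) uniformity}"

definition pseudometric :: "('a \<Rightarrow> 'a \<Rightarrow> real) \<Rightarrow> bool"
  where "pseudometric \<rho> \<longleftrightarrow>
    (\<forall>x y. 0 \<le> \<rho> x y) \<and> (\<forall>x. \<rho> x x = 0) \<and> (\<forall>x y. \<rho> x y = \<rho> y x) \<and>
    (\<forall>x y z. \<rho> x z \<le> \<rho> x y + \<rho> y z)"

definition pm_ball :: "('a \<Rightarrow> 'a \<Rightarrow> real) \<Rightarrow> real \<Rightarrow> ('a \<times> 'a) set"
  where "pm_ball \<rho> r = {(x, y). \<rho> x y < r}"

text \<open>
  The pseudometrics in a generating family are automatically uniformly continuous,
  so this is not required separately.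
\<close>

definition generates_uniformity :: "('a::uniform_space \<Rightarrow> 'a \<Rightarrow> real) set \<Rightarrow> bool"
  where "generates_uniformity F \<longleftrightarrow>
    uniformity = (INF (\<rho>, r) \<in> F \<times> {0<..}. principal (pm_ball \<rho> r))"

text \<open>
  The multiple \<open>\<alpha>V\<close> of a basic entourage depends on how \<open>V\<close> is written as a finite
  intersection. A basic entourage is therefore represented by the nonempty list of the
  pairs \<open>(\<rho>\<^sub>i, r\<^sub>i)\<close>; \<open>entourage_of\<close> is the relation it denotes.
\<close>

definition presentations ::
    "('a \<Rightarrow> 'a \<Rightarrow> real) set \<Rightarrow> (('a \<Rightarrow> 'a \<Rightarrow> real) \<times> real) list set"
  where "presentations F = {V. V \<noteq> [] \<and> (\<forall>(\<rho>, r) \<in> set V. \<rho> \<in> F \<and> 0 < r)}"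

definition entourage_of :: "(('a \<Rightarrow> 'a \<Rightarrow> real) \<times> real) list \<Rightarrow> ('a \<times> 'a) set"
  where "entourage_of V = (\<Inter>(\<rho>, r) \<in> set V. pm_ball \<rho> r)"

definition scale ::
    "real \<Rightarrow> (('a \<Rightarrow> 'a \<Rightarrow> real) \<times> real) list \<Rightarrow> (('a \<Rightarrow> 'a \<Rightarrow> real) \<times> real) list"
  where "scale \<alpha> V = map (\<lambda>(\<rho>, r). (\<rho>, \<alpha> * r)) V"

lemma basic_entourages_base:
  assumes "F \<noteq> {}" and "generates_uniformity F"
  shows "U \<in> entourages \<longleftrightarrow> (\<exists>V \<in> presentations F. entourage_of V \<subseteq> U)"
proof -
  have "U \<in> entourages \<longleftrightarrow>
      (\<exists>X \<subseteq> F \<times> {0<..}. finite X \<and>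
        (INF (\<rho>, r) \<in> X. principal (pm_ball \<rho> r)) \<le> principal U)"
    using assms(2)
    unfolding entourages_def generates_uniformity_def mem_Collect_eq le_principal
    by (subst eventually_INF[symmetric]) simp
  also have "\<dots> \<longleftrightarrow>
      (\<exists>X \<subseteq> F \<times> {0<..}. finite X \<and> (\<Inter>(\<rho>, r) \<in> X. pm_ball \<rho> r) \<subseteq> U)"
    by (intro ex_cong1 conj_cong refl)
       (simp add: INF_principal_finite case_prod_unfold)
  also have "\<dots> \<longleftrightarrow> (\<exists>V \<in> presentations F. entourage_of V \<subseteq> U)"
  proof
    assume "\<exists>X \<subseteq> F \<times> {0<..}. finite X \<and> (\<Inter>(\<rho>, r) \<in> X. pm_ball \<rho> r) \<subseteq> U"
    then obtain X where X: "X \<subseteq> F \<times> {0<..}" "finite X" "(\<Inter>(\<rho>, r) \<in> X. pm_ball \<rho> r) \<subseteq> U"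
      by blast
    obtain xs where xs: "set xs = X" using finite_list[OF X(2)] by blast
    obtain \<rho> where "\<rho> \<in> F" using assms(1) by blast
    then have "(\<rho>, 1) # xs \<in> presentations F"
      using X(1) xs by (auto simp: presentations_def)
    moreover have "entourage_of ((\<rho>, 1) # xs) \<subseteq> U"
      using X(3) xs by (auto simp: entourage_of_def)
    ultimately show "\<exists>V \<in> presentations F. entourage_of V \<subseteq> U" by blast
  next
    assume "\<exists>V \<in> presentations F. entourage_of V \<subseteq> U"
    then obtain V where V: "V \<in> presentations F" "entourage_of V \<subseteq> U" by blast
    then show "\<exists>X \<subseteq> F \<times> {0<..}. finite X \<and> (\<Inter>(\<rho>, r) \<in> X. pm_ball \<rho> r) \<subseteq> U"
      by (intro exI[of _ "set V"]) (auto simp: presentations_def entourage_of_def)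
  qed
  finally show ?thesis .
qed

definition Cauchy_equivalent :: "(nat \<Rightarrow> 'a::uniform_space) \<Rightarrow> (nat \<Rightarrow> 'a) \<Rightarrow> bool"
  where "Cauchy_equivalent a b \<longleftrightarrow> Cauchy a \<and> Cauchy b \<and>
    (\<forall>U \<in> entourages. \<exists>N>0. \<forall>n\<ge>N. (a n, b n) \<in> U)"


section \<open>Graphs and contractions\<close>

text \<open>
  A directed graph without parallel edges on the whole type is given by its set \<open>E\<close> of edges.
\<close>

definition undirected :: "('a \<times> 'a) set \<Rightarrow> ('a \<times> 'a) set"
  where "undirected E = {(x, y). (x, y) \<in> E \<or> (y, x) \<in> E}"

definition weakly_connected :: "('a \<times> 'a) set \<Rightarrow> bool"
  where "weakly_connected E \<longleftrightarrow>
    (\<forall>x y. \<exists>(N::nat) p. p 0 = x \<and> p N = y \<and> (\<forall>i \<in> {1..N}. (p (i - 1), p i) \<in> undirected E))"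

definition Banach_G_contraction ::
    "('a \<Rightarrow> 'a \<Rightarrow> real) set \<Rightarrow> ('a \<times> 'a) set \<Rightarrow> ('a \<Rightarrow> 'a) \<Rightarrow> bool"
  where "Banach_G_contraction F E T \<longleftrightarrow>
    (\<forall>x y. (x, y) \<in> E \<longrightarrow> (T x, T y) \<in> E) \<and>
    (\<exists>\<alpha>. 0 < \<alpha> \<and> \<alpha> < 1 \<and>
      (\<forall>x y. \<forall>V \<in> presentations F.
        (x, y) \<in> entourage_of V \<inter> E \<longrightarrow> (T x, T y) \<in> entourage_of (scale \<alpha> V)))"

end

theory Submission
  imports Defs
begin

text \<open>
  A Banach \<open>G\<close>-contraction shrinks every pseudometric of the family along edges by a factor
  \<open>\<alpha>\<close>. Summing over a path, \<open>\<rho> (T\<^sup>n x) (T\<^sup>n y)\<close> decays like \<open>\<alpha>\<^sup>n\<close>, which for \<open>y = T x\<close>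
  also makes the orbit Cauchy. Conversely, if \<open>y\<close> lies outside the component \<open>S\<close> of \<open>x\<close>, then
  the map sending \<open>S\<close> to \<open>x\<close> and its complement to \<open>y\<close> is a contraction with two fixed points.
\<close>

text \<open>Makes path arguments available as \<open>rtrancl\<close> induction, and lets the
  component of a point be written as a closure.\<close>

lemma weakly_connected_iff_rtrancl:
  "weakly_connected E \<longleftrightarrow> (\<forall>x y. (x, y) \<in> (undirected E)\<^sup>*)"
proof -
  have steps: "(\<forall>i\<in>{1..N}. (p (i - 1), p i) \<in> R) \<longleftrightarrow> (\<forall>i<N. (p i, p (Suc i)) \<in> R)"
    for N :: nat and p :: "nat \<Rightarrow> 'a" and R
  proof -
    \<comment> \<open>Index shift: the definition numbers the edges of a path from 1,
      \<open>relpow_fun_conv\<close> numbers them from 0.\<close>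
    have "{1..N} = Suc ` {..<N}"
      by (simp add: image_Suc_lessThan)
    show ?thesis unfolding \<open>{1..N} = Suc ` {..<N}\<close> by auto
  qed
  show ?thesis
    unfolding weakly_connected_def rtrancl_power relpow_fun_conv
    by (simp only: steps)
qed

text \<open>Convergence to an infimum of filters is tested on each member, so one pseudometric and
  one radius at a time suffice; finite intersections never have to be handled.\<close>

lemma filterlim_uniformity_iff:
  fixes F :: "('a::uniform_space \<Rightarrow> 'a \<Rightarrow> real) set"
  assumes "generates_uniformity F"
  shows "filterlim (\<lambda>t. (f t, g t)) uniformity G \<longleftrightarrow>
    (\<forall>\<rho>\<in>F. \<forall>r>0. \<forall>\<^sub>F t in G. \<rho> (f t) (g t) < r)"
  unfolding assms[unfolded generates_uniformity_def] filterlim_INF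
  by (auto simp: filterlim_principal pm_ball_def)

text \<open>Puts the Cauchy property into the form to which the pseudometric criterion for
  \<open>filterlim\<close> applies.\<close>

lemma Cauchy_iff_filterlim:
  fixes X :: "nat \<Rightarrow> 'a::uniform_space"
  shows "Cauchy X \<longleftrightarrow>
    filterlim (\<lambda>p. (X (fst p), X (snd p))) uniformity (sequentially \<times>\<^sub>F sequentially)"
  unfolding Cauchy_uniform_iff filterlim_iff eventually_prod_sequentially fst_conv snd_conv
  by metis

lemma Cauchy_equivalent_iff_filterlim:
  "Cauchy_equivalent a b \<longleftrightarrow>
    Cauchy a \<and> Cauchy b \<and> filterlim (\<lambda>n. (a n, b n)) uniformity sequentially"
proof -
  \<comment> \<open>A threshold may be replaced by its successor, so demanding that it be positive
    changes nothing.\<close>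
  have N: "(\<exists>N>0. \<forall>n\<ge>N. P n) \<longleftrightarrow> eventually P sequentially" for P :: "nat \<Rightarrow> bool"
    unfolding eventually_sequentially by (meson Suc_leD zero_less_Suc)
  have "(\<forall>U\<in>entourages. Q U) \<longleftrightarrow> (\<forall>P. eventually P uniformity \<longrightarrow> Q (Collect P))"
    for Q :: "('a \<times> 'a) set \<Rightarrow> bool"
  proof
    assume R: "\<forall>P. eventually P uniformity \<longrightarrow> Q (Collect P)"
    show "\<forall>U\<in>entourages. Q U"
      using R[THEN spec, of "\<lambda>p. p \<in> U" for U] by (simp add: entourages_def)
  qed (simp add: entourages_def)
  then show ?thesis
    unfolding Cauchy_equivalent_def filterlim_iff N by simp
qed

text \<open>The ratio \<alpha> is common to all pseudometrics and points; only C varies, being the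
  sum of the \<open>\<rho>\<close>-lengths of the edges on a path from x to y.\<close>

lemma contraction_geometric_decay:
  assumes "weakly_connected E"
    and pm: "\<And>\<rho>. \<rho> \<in> F \<Longrightarrow> pseudometric \<rho>"
    and T: "Banach_G_contraction F E T"
  obtains \<alpha> where "0 < \<alpha>" "\<alpha> < 1"
    "\<And>\<rho> x y. \<rho> \<in> F \<Longrightarrow> \<exists>C. \<forall>n. \<rho> ((T ^^ n) x) ((T ^^ n) y) \<le> C * \<alpha> ^ n"
proof -
  obtain \<alpha> where \<alpha>: "0 < \<alpha>" "\<alpha> < 1"
    and contr: "\<And>x y V. \<lbrakk>V \<in> presentations F; (x, y) \<in> entourage_of V; (x, y) \<in> E\<rbrakk>
      \<Longrightarrow> (T x, T y) \<in> entourage_of (scale \<alpha> V)"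
    and pres: "\<And>x y. (x, y) \<in> E \<Longrightarrow> (T x, T y) \<in> E"
    using T unfolding Banach_G_contraction_def by blast
  have edge: "\<rho> (T x) (T y) \<le> \<alpha> * \<rho> x y" if \<rho>: "\<rho> \<in> F" and e: "(x, y) \<in> E" for \<rho> x y
  proof (rule dense_ge)
    \<comment> \<open>Balls are strict, so the bound is approached from above: the radius
      \<open>z / \<alpha>\<close> exceeds \<open>\<rho> x y\<close>, and scaling by \<alpha> turns
      it back into z.\<close>
    fix z assume z: "\<alpha> * \<rho> x y < z"
    have "0 \<le> \<rho> x y" using pm[OF \<rho>] by (simp add: pseudometric_def)
    then have "0 < z" using z \<alpha>(1) by (smt (verit) mult_nonneg_nonneg)
    then have "[(\<rho>, z / \<alpha>)] \<in> presentations F"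
      using \<rho> \<alpha>(1) by (simp add: presentations_def)
    moreover have "(x, y) \<in> entourage_of [(\<rho>, z / \<alpha>)]"
      using z \<alpha>(1) by (simp add: entourage_of_def pm_ball_def field_simps)
    ultimately have "(T x, T y) \<in> entourage_of (scale \<alpha> [(\<rho>, z / \<alpha>)])"
      using contr e by blast
    then show "\<rho> (T x) (T y) \<le> z"
      using \<alpha>(1) by (simp add: entourage_of_def scale_def pm_ball_def)
  qed
  have iter_edge: "((T ^^ n) x, (T ^^ n) y) \<in> E" if "(x, y) \<in> E" for n x y
    by (induction n) (simp_all add: that pres)
  have iter: "\<rho> ((T ^^ n) x) ((T ^^ n) y) \<le> \<rho> x y * \<alpha> ^ n"
    if \<rho>: "\<rho> \<in> F" and e: "(x, y) \<in> E" for \<rho> n x y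
  proof (induction n)
    case (Suc n)
    have "\<rho> ((T ^^ Suc n) x) ((T ^^ Suc n) y) \<le> \<alpha> * \<rho> ((T ^^ n) x) ((T ^^ n) y)"
      using edge[OF \<rho> iter_edge[OF e]] by simp
    also have "\<dots> \<le> \<alpha> * (\<rho> x y * \<alpha> ^ n)"
      using Suc \<alpha>(1) by (intro mult_left_mono) auto
    finally show ?case by (simp add: mult_ac)
  qed simp
  have "\<exists>C. \<forall>n. \<rho> ((T ^^ n) x) ((T ^^ n) y) \<le> C * \<alpha> ^ n" if \<rho>: "\<rho> \<in> F" for \<rho> x y
  proof -
    have refl: "\<rho> u u = 0" and sym: "\<rho> u v = \<rho> v u" and tri: "\<rho> u w \<le> \<rho> u v + \<rho> v w" for u v w
      using pm[OF \<rho>] by (simp_all add: pseudometric_def)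
    have "(x, y) \<in> (undirected E)\<^sup>*"
      using assms(1) by (simp add: weakly_connected_iff_rtrancl)
    then show ?thesis
    proof (induction rule: rtrancl_induct)
      case base
      show ?case by (intro exI[of _ 0]) (simp add: refl)
    next
      case (step y z)
      then obtain C where C: "\<rho> ((T ^^ n) x) ((T ^^ n) y) \<le> C * \<alpha> ^ n" for n by blast
      \<comment> \<open>The edge may point either way; symmetry of \<open>\<rho>\<close> covers the
        reversed case.\<close>
      have yz: "\<rho> ((T ^^ n) y) ((T ^^ n) z) \<le> \<rho> y z * \<alpha> ^ n" for n
        using step(2) iter[OF \<rho>, of y z n] iter[OF \<rho>, of z y n]
          sym[of y z] sym[of "(T ^^ n) y" "(T ^^ n) z"]
        unfolding undirected_def by auto
      have "\<rho> ((T ^^ n) x) ((T ^^ n) z) \<le> (C + \<rho> y z) * \<alpha> ^ n" for n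
        using tri[of "(T ^^ n) x" "(T ^^ n) z" "(T ^^ n) y"] C[of n] yz[of n]
        by (simp add: distrib_right)
      then show ?case by blast
    qed
  qed
  with \<alpha> that show thesis by blast
qed

text \<open>The triangle inequality bounds the distance by a tail of a geometric series.\<close>

lemma pseudometric_geometric_steps:
  assumes "pseudometric \<rho>" "0 < \<alpha>" "\<alpha> < 1"
    and step: "\<And>n. \<rho> (X n) (X (Suc n)) \<le> C * \<alpha> ^ n"
  obtains K where "\<And>m n. m \<le> n \<Longrightarrow> \<rho> (X m) (X n) \<le> K * \<alpha> ^ m"
proof
  have nonneg: "0 \<le> \<rho> u v" and refl: "\<rho> u u = 0" and tri: "\<rho> u w \<le> \<rho> u v + \<rho> v w" for u v w
    using assms(1) by (simp_all add: pseudometric_def)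
  \<comment> \<open>The sum of the series with terms \<open>C * \<alpha> ^ n\<close>.\<close>
  define K where "K = C / (1 - \<alpha>)"
  have C: "C = K * (1 - \<alpha>)" using \<open>\<alpha> < 1\<close> by (simp add: K_def)
  have K: "0 \<le> K"
    unfolding K_def using step[of 0] nonneg[of "X 0" "X (Suc 0)"] \<open>\<alpha> < 1\<close> by simp
  fix m n :: nat assume "m \<le> n"
  \<comment> \<open>Keeping the subtracted term makes the induction telescope, because
    \<open>C * \<alpha> ^ n = K * (\<alpha> ^ n - \<alpha> ^ Suc n)\<close>.\<close>
  then have "\<rho> (X m) (X n) \<le> K * (\<alpha> ^ m - \<alpha> ^ n)"
  proof (induction n rule: dec_induct)
    case base
    show ?case by (simp add: refl)
  next
    case (step n)
    then show ?case
      using tri[of "X m" "X (Suc n)" "X n"] assms(4)[of n]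
      by (simp add: C algebra_simps)
  qed
  also have "\<dots> \<le> K * \<alpha> ^ m"
    using K \<open>0 < \<alpha>\<close> by (intro mult_left_mono) auto
  finally show "\<rho> (X m) (X n) \<le> K * \<alpha> ^ m" .
qed

lemma eventually_geometric_less:
  fixes \<alpha> :: real
  assumes "0 < \<alpha>" "\<alpha> < 1" "0 < r"
  shows "\<forall>\<^sub>F n in sequentially. K * \<alpha> ^ n < r"
proof -
  have "(\<lambda>n. K * \<alpha> ^ n) \<longlonglongrightarrow> K * 0"
    using assms by (intro tendsto_mult_left LIMSEQ_power_zero) simp
  then show ?thesis using \<open>0 < r\<close> by (auto dest: order_tendstoD(2))
qed

lemma geometric_steps_Cauchy:
  fixes F :: "('a::uniform_space \<Rightarrow> 'a \<Rightarrow> real) set"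
  assumes gen: "generates_uniformity F"
    and pm: "\<And>\<rho>. \<rho> \<in> F \<Longrightarrow> pseudometric \<rho>"
    and \<alpha>: "0 < \<alpha>" "\<alpha> < 1"
    and step: "\<And>\<rho>. \<rho> \<in> F \<Longrightarrow> \<exists>C. \<forall>n. \<rho> (X n) (X (Suc n)) \<le> C * \<alpha> ^ n"
  shows "Cauchy X"
  unfolding Cauchy_iff_filterlim filterlim_uniformity_iff[OF gen]
proof (intro ballI allI impI)
  fix \<rho> and r :: real assume \<rho>: "\<rho> \<in> F" and r: "0 < r"
  obtain C where "\<And>n. \<rho> (X n) (X (Suc n)) \<le> C * \<alpha> ^ n" using step[OF \<rho>] by blast
  then obtain K where K: "\<And>m n. m \<le> n \<Longrightarrow> \<rho> (X m) (X n) \<le> K * \<alpha> ^ m"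
    using pseudometric_geometric_steps[OF pm[OF \<rho>] \<alpha>] by metis
  obtain N where N: "\<And>n. n \<ge> N \<Longrightarrow> K * \<alpha> ^ n < r"
    using eventually_geometric_less[OF \<alpha> r] unfolding eventually_sequentially by blast
  have sym: "\<rho> u v = \<rho> v u" for u v
    using pm[OF \<rho>] by (simp add: pseudometric_def)
  \<comment> \<open>The bound by K needs ordered indices; symmetry of \<open>\<rho>\<close> reduces
    to that case.\<close>
  have "\<rho> (X m) (X n) < r" if "m \<ge> N" "n \<ge> N" for m n
    using that K[of m n] K[of n m] N[of m] N[of n] sym[of "X m" "X n"] by linarith
  then show "\<forall>\<^sub>F p in sequentially \<times>\<^sub>F sequentially. \<rho> (X (fst p)) (X (snd p)) < r"
    unfolding eventually_prod_sequentially by auto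
qed

lemma weakly_connected_imp_Cauchy_equivalent:
  fixes F :: "('a::uniform_space \<Rightarrow> 'a \<Rightarrow> real) set"
  assumes "weakly_connected E"
    and gen: "generates_uniformity F"
    and pm: "\<And>\<rho>. \<rho> \<in> F \<Longrightarrow> pseudometric \<rho>"
    and "Banach_G_contraction F E T"
  shows "Cauchy_equivalent (\<lambda>n. (T ^^ n) x) (\<lambda>n. (T ^^ n) y)"
proof -
  obtain \<alpha> where \<alpha>: "0 < \<alpha>" "\<alpha> < 1" and
    decay: "\<And>\<rho> x y. \<rho> \<in> F \<Longrightarrow> \<exists>C. \<forall>n. \<rho> ((T ^^ n) x) ((T ^^ n) y) \<le> C * \<alpha> ^ n"
    using contraction_geometric_decay[OF assms(1) pm assms(4)] by blast
  \<comment> \<open>Decay for the pair x, \<open>T x\<close> is exactly a geometric bound on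
    consecutive orbit points.\<close>
  have "Cauchy (\<lambda>n. (T ^^ n) x)" for x
    using decay[of _ x "T x"]
    by (intro geometric_steps_Cauchy[OF gen pm \<alpha>]) (simp_all add: funpow_swap1)
  moreover have "filterlim (\<lambda>n. ((T ^^ n) x, (T ^^ n) y)) uniformity sequentially"
    unfolding filterlim_uniformity_iff[OF gen]
  proof (intro ballI allI impI)
    fix \<rho> and r :: real assume "\<rho> \<in> F" and r: "0 < r"
    then obtain C where C: "\<And>n. \<rho> ((T ^^ n) x) ((T ^^ n) y) \<le> C * \<alpha> ^ n"
      using decay by blast
    show "\<forall>\<^sub>F n in sequentially. \<rho> ((T ^^ n) x) ((T ^^ n) y) < r"
      using eventually_geometric_less[OF \<alpha> r, of C]
      by eventually_elim (rule le_less_trans[OF C])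
  qed
  ultimately show ?thesis by (simp add: Cauchy_equivalent_iff_filterlim)
qed

text \<open>For constant sequences, eventual membership of the pair in each entourage is membership
  outright, and separatedness then applies.\<close>

lemma Cauchy_equivalent_const_imp_eq:
  fixes x y :: "'a::uniform_space"
  assumes "\<Inter>(entourages :: ('a \<times> 'a) set set) = Id"
    and "Cauchy_equivalent (\<lambda>_. x) (\<lambda>_. y)"
  shows "x = y"
proof -
  have "(x, y) \<in> \<Inter>entourages"
    using assms(2) unfolding Cauchy_equivalent_def by blast
  then show ?thesis unfolding assms(1) by simp
qed

lemma at_most_one_fixed_point_imp_weakly_connected:
  assumes pm: "\<And>\<rho>. \<rho> \<in> F \<Longrightarrow> pseudometric \<rho>"
    and loops: "Id \<subseteq> E"
    and uniq: "\<And>T. Banach_G_contraction F E T \<Longrightarrow> \<exists>\<^sub>\<le>\<^sub>1 x. T x = x"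
  shows "weakly_connected E"
  unfolding weakly_connected_iff_rtrancl
proof (intro allI, rule ccontr)
  fix x y assume y: "(x, y) \<notin> (undirected E)\<^sup>*"
  define S where "S = {z. (x, z) \<in> (undirected E)\<^sup>*}"
  define T where "T z = (if z \<in> S then x else y)" for z
  \<comment> \<open>No edge leaves or enters the component \<open>S\<close>, so both endpoints take
    the same value.\<close>
  have T_edge: "T u = T v" if "(u, v) \<in> E" for u v
  proof -
    have "(u, v) \<in> undirected E" "(v, u) \<in> undirected E"
      using that by (auto simp: undirected_def)
    then have "u \<in> S \<longleftrightarrow> v \<in> S"
      unfolding S_def by (auto intro: rtrancl_into_rtrancl)
    then show ?thesis by (simp add: T_def)
  qed
  have diag: "(u, u) \<in> entourage_of (scale (1/2) V)" if "V \<in> presentations F" for u V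
    using that pm
    by (force simp: entourage_of_def scale_def pm_ball_def presentations_def pseudometric_def)
  have "Banach_G_contraction F E T"
    unfolding Banach_G_contraction_def
  \<comment> \<open>Any ratio in (0,1) would do: edges are mapped to diagonal pairs, which are edges
    by \<open>loops\<close> and lie in every scaled entourage.\<close>
  proof (intro conjI exI[of _ "1/2 :: real"] allI impI ballI)
    fix u v assume "(u, v) \<in> E"
    then show "(T u, T v) \<in> E" using T_edge loops by fastforce
  next
    fix u v V assume "V \<in> presentations F" "(u, v) \<in> entourage_of V \<inter> E"
    then show "(T u, T v) \<in> entourage_of (scale (1/2) V)" using T_edge diag by fastforce
  qed simp_all
  moreover have "T x = x" "T y = y" using y by (auto simp: T_def S_def)
  ultimately have "x = y" using uniq by (auto dest: Uniq_D)
  with y show False by simp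
qed

theorem theorem1:
  fixes F :: "('a::uniform_space \<Rightarrow> 'a \<Rightarrow> real) set"
    and E :: "('a \<times> 'a) set"
  assumes separated: "\<Inter>(entourages :: ('a \<times> 'a) set set) = Id"
    and F_nonempty: "F \<noteq> {}"
    and F_pseudometrics: "\<And>\<rho>. \<rho> \<in> F \<Longrightarrow> pseudometric \<rho>"
    and F_generates: "generates_uniformity F"
    and loops: "Id \<subseteq> E"
  shows "(weakly_connected E \<longleftrightarrow>
           (\<forall>T. Banach_G_contraction F E T \<longrightarrow>
              (\<forall>x y. Cauchy_equivalent (\<lambda>n. (T ^^ n) x) (\<lambda>n. (T ^^ n) y)))) \<and>
         (weakly_connected E \<longleftrightarrow>
           (\<forall>T. Banach_G_contraction F E T \<longrightarrow> (\<exists>\<^sub>\<le>\<^sub>1 x. T x = x)))"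
    (is "(?i \<longleftrightarrow> ?ii) \<and> (?i \<longleftrightarrow> ?iii)")
proof -
  have "?i \<Longrightarrow> ?ii"
    using weakly_connected_imp_Cauchy_equivalent[OF _ F_generates F_pseudometrics] by blast
  moreover have "?ii \<Longrightarrow> ?iii"
  proof (intro allI impI Uniq_I)
    fix T x y assume ?ii "Banach_G_contraction F E T" and fixed: "T x = x" "T y = y"
    then have "Cauchy_equivalent (\<lambda>n. (T ^^ n) x) (\<lambda>n. (T ^^ n) y)" by blast
    \<comment> \<open>Orbits of fixed points are constant, which reduces uniqueness to the case of
      constant sequences.\<close>
    moreover have "(T ^^ n) x = x" "(T ^^ n) y = y" for n
      by (induction n) (simp_all add: fixed)
    ultimately show "x = y" using Cauchy_equivalent_const_imp_eq[OF separated] by simp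
  qed
  moreover have "?iii \<Longrightarrow> ?i"
    using at_most_one_fixed_point_imp_weakly_connected[OF F_pseudometrics loops] by blast
  ultimately show ?thesis by blast
qed

end
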